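(* Let $A$ be an MV-algebra and $M$ a cyclic $A$-semimodule. Then the following are equivalent: (a) $M$ is projective; (b) there exists $u\in A$ such that $M\cong A\odot u$ and $u\odot u=u$; (c) $M$ is a direct summand of the free semimodule $A$, i.e. there exists a subsemimodule $N$ of $A$ such that $A\cong M\oplus N$.
   Context: An MV-algebra $\langle A,\oplus,{}^*,\mathbf 0\rangle$ is an algebra of type $(2,1,0)$ such that $\langle A,\oplus,\mathbf 0\rangle$ is a commutative monoid, $(x^* )^*=x$, $x\oplus\mathbf 0^*=\mathbf 0^*$, and $(x^*\oplus y)^*\oplus y=(y^*\oplus x)^*\oplus x$. Put $\mathbf 1=\mathbf 0^*$, $x\odot y=(x^*\oplus y^* )^*$, $x\vee y=(x\odot y^* )\oplus y$. Then $A^{\vee\odot}=\langle A,\vee,\odot,\mathbf 0,\mathbf 1\rangle$ is a commutative semiring with idempotent sum, and an $A$-semimodule means a semimodule over the semiring $A^{\vee\odot}$. A semimodule over a semiring $S$ is a commutative monoid $\langle M,+,0\rangle$ with a scalar multiplication $S\times M\to M$ such that $(ab)x=a(bx)$, $a(x+y)=ax+ay$, $(a+b)x=ax+bx$, $0_S x=0_M=a0_M$, $1x=x$; homomorphisms preserve sums and scalar multiplication. A semimodule is cyclic if it is generated by one element. $A$ itself is regarded as an $A$-semimodule $\langle A,\vee,\mathbf 0\rangle$ with scalar multiplication $\odot$; it is free on one generator. $A\odot u=\{a\odot u: a\in A\}$ is the subsemimodule of $A$ generated by $u$. Here $M\oplus N$ between semimodules denotes the direct sum, i.e. the coproduct in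 the category of $A$-semimodules. An $A$-semimodule $P$ is projective if every homomorphism from $P$ lifts along every surjective homomorphism of $A$-semimodules. *)

theory Defs
  imports "HOL-Algebra.Module"
begin

section \<open>Semimodules over a semiring\<close>

text \<open>
  Semimodules reuse the record type \<^typ>\<open>('a, 'b) module\<close>. As in \<^locale>\<open>module\<close>, the
  components \<^const>\<open>mult\<close> and \<^const>\<open>one\<close> of the second structure play no role.
\<close>

locale semimodule = R?: semiring R + M?: abelian_monoid M
  for R (structure) and M (structure) +
  assumes smult_closed [simp, intro]:
      "\<lbrakk> a \<in> carrier R; x \<in> carrier M \<rbrakk> \<Longrightarrow> a \<odot>\<^bsub>M\<^esub> x \<in> carrier M"
    and smult_assoc:
      "\<lbrakk> a \<in> carrier R; b \<in> carrier R; x \<in> carrier M \<rbrakk> \<Longrightarrow>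
        (a \<otimes>\<^bsub>R\<^esub> b) \<odot>\<^bsub>M\<^esub> x = a \<odot>\<^bsub>M\<^esub> (b \<odot>\<^bsub>M\<^esub> x)"
    and smult_r_distr:
      "\<lbrakk> a \<in> carrier R; x \<in> carrier M; y \<in> carrier M \<rbrakk> \<Longrightarrow>
        a \<odot>\<^bsub>M\<^esub> (x \<oplus>\<^bsub>M\<^esub> y) = a \<odot>\<^bsub>M\<^esub> x \<oplus>\<^bsub>M\<^esub> a \<odot>\<^bsub>M\<^esub> y"
    and smult_l_distr:
      "\<lbrakk> a \<in> carrier R; b \<in> carrier R; x \<in> carrier M \<rbrakk> \<Longrightarrow>
        (a \<oplus>\<^bsub>R\<^esub> b) \<odot>\<^bsub>M\<^esub> x = a \<odot>\<^bsub>M\<^esub> x \<oplus>\<^bsub>M\<^esub> b \<odot>\<^bsub>M\<^esub> x"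
    and smult_l_zero [simp]: "x \<in> carrier M \<Longrightarrow> \<zero>\<^bsub>R\<^esub> \<odot>\<^bsub>M\<^esub> x = \<zero>\<^bsub>M\<^esub>"
    and smult_r_zero [simp]: "a \<in> carrier R \<Longrightarrow> a \<odot>\<^bsub>M\<^esub> \<zero>\<^bsub>M\<^esub> = \<zero>\<^bsub>M\<^esub>"
    and smult_one [simp]: "x \<in> carrier M \<Longrightarrow> \<one>\<^bsub>R\<^esub> \<odot>\<^bsub>M\<^esub> x = x"

text \<open>Preservation of zero is automatic, since \<open>\<zero> = \<zero>\<^bsub>R\<^esub> \<odot> x\<close> in a semimodule.\<close>

definition semimodule_hom ::
    "('a, 'r) ring_scheme \<Rightarrow> ('a, 'm, 'p) module_scheme \<Rightarrow> ('a, 'n, 'q) module_scheme \<Rightarrow> ('m \<Rightarrow> 'n) set"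
  where "semimodule_hom R M N = {h \<in> carrier M \<rightarrow> carrier N.
    (\<forall>x \<in> carrier M. \<forall>y \<in> carrier M. h (x \<oplus>\<^bsub>M\<^esub> y) = h x \<oplus>\<^bsub>N\<^esub> h y) \<and>
    (\<forall>a \<in> carrier R. \<forall>x \<in> carrier M. h (a \<odot>\<^bsub>M\<^esub> x) = a \<odot>\<^bsub>N\<^esub> h x)}"

definition semimodule_isomorphic ::
    "('a, 'r) ring_scheme \<Rightarrow> ('a, 'm, 'p) module_scheme \<Rightarrow> ('a, 'n, 'q) module_scheme \<Rightarrow> bool"
  where "semimodule_isomorphic R M N \<longleftrightarrow>
    (\<exists>h \<in> semimodule_hom R M N. bij_betw h (carrier M) (carrier N))"

definition subsemimodule ::
    "'m set \<Rightarrow> ('a, 'r) ring_scheme \<Rightarrow> ('a, 'm, 'p) module_scheme \<Rightarrow> bool"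
  where "subsemimodule H R M \<longleftrightarrow> H \<subseteq> carrier M \<and> \<zero>\<^bsub>M\<^esub> \<in> H \<and>
    (\<forall>x \<in> H. \<forall>y \<in> H. x \<oplus>\<^bsub>M\<^esub> y \<in> H) \<and>
    (\<forall>a \<in> carrier R. \<forall>x \<in> H. a \<odot>\<^bsub>M\<^esub> x \<in> H)"

definition subsemimodule_generated ::
    "('a, 'r) ring_scheme \<Rightarrow> ('a, 'm, 'p) module_scheme \<Rightarrow> 'm set \<Rightarrow> 'm set"
  where "subsemimodule_generated R M S = \<Inter> {H. subsemimodule H R M \<and> S \<subseteq> H}"

definition cyclic_semimodule ::
    "('a, 'r) ring_scheme \<Rightarrow> ('a, 'm, 'p) module_scheme \<Rightarrow> bool"
  where "cyclic_semimodule R M \<longleftrightarrow>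
    (\<exists>x \<in> carrier M. subsemimodule_generated R M {x} = carrier M)"

text \<open>
  A formula of higher-order logic cannot quantify over types, so the lifting property is tested on
  the \<^const>\<open>semimodule\<close>s whose carriers are arbitrary subsets of a type \<^typ>\<open>'u\<close>, which plays
  the role of a universe and is passed as a parameter. If \<^typ>\<open>'u\<close> is instantiated by a sum
  \<^typ>\<open>'a + 'm + 'b\<close>, the carrier types \<^typ>\<open>'a\<close> of the semiring and \<^typ>\<open>'m\<close> of the semimodule
  embed in the universe, and since \<^typ>\<open>'b\<close> is arbitrary, so does every other type.
\<close>

definition projective_semimodule ::
    "'u itself \<Rightarrow> ('a, 'r) ring_scheme \<Rightarrow> ('a, 'm, 'p) module_scheme \<Rightarrow> bool"
  where "projective_semimodule U R P \<longleftrightarrow>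
    (\<forall>(B :: ('a, 'u) module) (C :: ('a, 'u) module) g f.
       semimodule R B \<longrightarrow> semimodule R C \<longrightarrow>
       g \<in> semimodule_hom R B C \<longrightarrow> g ` carrier B = carrier C \<longrightarrow>
       f \<in> semimodule_hom R P C \<longrightarrow>
       (\<exists>h \<in> semimodule_hom R P B. \<forall>x \<in> carrier P. g (h x) = f x))"

definition semimodule_direct_sum ::
    "('a, 'm, 'p) module_scheme \<Rightarrow> ('a, 'n, 'q) module_scheme \<Rightarrow> ('a, 'm \<times> 'n) module"
  where "semimodule_direct_sum M N =
    \<lparr> carrier = carrier M \<times> carrier N,
      mult = undefined, one = undefined,
      zero = (\<zero>\<^bsub>M\<^esub>, \<zero>\<^bsub>N\<^esub>),
      add = (\<lambda>(x, y) (x', y'). (x \<oplus>\<^bsub>M\<^esub> x', y \<oplus>\<^bsub>N\<^esub> y')),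
      smult = (\<lambda>a (x, y). (a \<odot>\<^bsub>M\<^esub> x, a \<odot>\<^bsub>N\<^esub> y)) \<rparr>"

lemma semimodule_direct_sum:
  assumes "semimodule R M" "semimodule R N"
  shows "semimodule R (semimodule_direct_sum M N)"
proof -
  interpret M: semimodule R M by fact
  interpret N: semimodule R N by fact
  show ?thesis
    by unfold_locales
      (auto simp: semimodule_direct_sum_def M.M.a_ac N.M.a_ac
        M.smult_assoc N.smult_assoc M.smult_l_distr N.smult_l_distr
        M.smult_r_distr N.smult_r_distr Units_def)
qed

text \<open>
  The componentwise construction is the coproduct, with the injections
  \<open>x \<mapsto> (x, \<zero>)\<close> and \<open>y \<mapsto> (\<zero>, y)\<close>.
\<close>

lemma semimodule_direct_sum_injections:
  assumes "semimodule R M" "semimodule R N"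
  shows "(\<lambda>x. (x, \<zero>\<^bsub>N\<^esub>)) \<in> semimodule_hom R M (semimodule_direct_sum M N)"
    and "(\<lambda>y. (\<zero>\<^bsub>M\<^esub>, y)) \<in> semimodule_hom R N (semimodule_direct_sum M N)"
proof -
  interpret M: semimodule R M by fact
  interpret N: semimodule R N by fact
  show "(\<lambda>x. (x, \<zero>\<^bsub>N\<^esub>)) \<in> semimodule_hom R M (semimodule_direct_sum M N)"
    and "(\<lambda>y. (\<zero>\<^bsub>M\<^esub>, y)) \<in> semimodule_hom R N (semimodule_direct_sum M N)"
    by (auto simp: semimodule_hom_def semimodule_direct_sum_def)
qed

lemma semimodule_direct_sum_coproduct:
  assumes "semimodule R M" "semimodule R N" "semimodule R Q"
    and f: "f \<in> semimodule_hom R M Q" and g: "g \<in> semimodule_hom R N Q"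
  shows "\<exists>h \<in> semimodule_hom R (semimodule_direct_sum M N) Q.
    (\<forall>x \<in> carrier M. h (x, \<zero>\<^bsub>N\<^esub>) = f x) \<and> (\<forall>y \<in> carrier N. h (\<zero>\<^bsub>M\<^esub>, y) = g y) \<and>
    (\<forall>h' \<in> semimodule_hom R (semimodule_direct_sum M N) Q.
       (\<forall>x \<in> carrier M. h' (x, \<zero>\<^bsub>N\<^esub>) = f x) \<and> (\<forall>y \<in> carrier N. h' (\<zero>\<^bsub>M\<^esub>, y) = g y) \<longrightarrow>
       (\<forall>z \<in> carrier (semimodule_direct_sum M N). h' z = h z))"
proof -
  interpret M: semimodule R M by fact
  interpret N: semimodule R N by fact
  interpret Q: semimodule R Q by fact
  have fc: "f x \<in> carrier Q" if "x \<in> carrier M" for x using f that by (auto simp: semimodule_hom_def)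
  have gc: "g x \<in> carrier Q" if "x \<in> carrier N" for x using g that by (auto simp: semimodule_hom_def)
  have f0: "f \<zero>\<^bsub>M\<^esub> = \<zero>\<^bsub>Q\<^esub>"
  proof -
    have "f (\<zero>\<^bsub>R\<^esub> \<odot>\<^bsub>M\<^esub> \<zero>\<^bsub>M\<^esub>) = \<zero>\<^bsub>R\<^esub> \<odot>\<^bsub>Q\<^esub> f \<zero>\<^bsub>M\<^esub>"
      using f unfolding semimodule_hom_def by blast
    then show ?thesis by (simp add: fc)
  qed
  have g0: "g \<zero>\<^bsub>N\<^esub> = \<zero>\<^bsub>Q\<^esub>"
  proof -
    have "g (\<zero>\<^bsub>R\<^esub> \<odot>\<^bsub>N\<^esub> \<zero>\<^bsub>N\<^esub>) = \<zero>\<^bsub>R\<^esub> \<odot>\<^bsub>Q\<^esub> g \<zero>\<^bsub>N\<^esub>"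
      using g unfolding semimodule_hom_def by blast
    then show ?thesis by (simp add: gc)
  qed
  define h where "h = (\<lambda>(x, y). f x \<oplus>\<^bsub>Q\<^esub> g y)"
  have h: "h \<in> semimodule_hom R (semimodule_direct_sum M N) Q"
    using f g
    by (auto simp: h_def semimodule_hom_def semimodule_direct_sum_def Pi_iff Q.smult_r_distr
        Q.M.a_ac)
  have uniq: "h' (x, y) = h (x, y)"
    if h': "h' \<in> semimodule_hom R (semimodule_direct_sum M N) Q"
      and e: "\<forall>x \<in> carrier M. h' (x, \<zero>\<^bsub>N\<^esub>) = f x" "\<forall>y \<in> carrier N. h' (\<zero>\<^bsub>M\<^esub>, y) = g y"
      and xy: "x \<in> carrier M" "y \<in> carrier N" for h' x y
  proof -
    let ?S = "semimodule_direct_sum M N"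
    have "h' ((x, \<zero>\<^bsub>N\<^esub>) \<oplus>\<^bsub>?S\<^esub> (\<zero>\<^bsub>M\<^esub>, y)) = h' (x, \<zero>\<^bsub>N\<^esub>) \<oplus>\<^bsub>Q\<^esub> h' (\<zero>\<^bsub>M\<^esub>, y)"
    proof -
      have "(x, \<zero>\<^bsub>N\<^esub>) \<in> carrier ?S" "(\<zero>\<^bsub>M\<^esub>, y) \<in> carrier ?S"
        using xy by (auto simp: semimodule_direct_sum_def)
      then show ?thesis using h' unfolding semimodule_hom_def by blast
    qed
    moreover have "(x, \<zero>\<^bsub>N\<^esub>) \<oplus>\<^bsub>?S\<^esub> (\<zero>\<^bsub>M\<^esub>, y) = (x, y)"
      using xy by (simp add: semimodule_direct_sum_def)
    ultimately show ?thesis using e xy by (simp add: h_def)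
  qed
  show ?thesis
    using uniq fc gc f0 g0
    by (intro bexI[OF _ h]) (auto simp: h_def semimodule_direct_sum_def)
qed


section \<open>MV-algebras\<close>

record 'a mv = "'a partial_object" +
  mv_plus :: "'a \<Rightarrow> 'a \<Rightarrow> 'a"
  mv_neg :: "'a \<Rightarrow> 'a"
  mv_zero :: 'a

locale mv_algebra =
  fixes A :: "('a, 'r) mv_scheme" (structure)
  assumes comm_monoid: "comm_monoid \<lparr> carrier = carrier A, mult = mv_plus A, one = mv_zero A \<rparr>"
    and neg_closed: "x \<in> carrier A \<Longrightarrow> mv_neg A x \<in> carrier A"
    and neg_neg: "x \<in> carrier A \<Longrightarrow> mv_neg A (mv_neg A x) = x"
    and plus_neg_zero:
      "x \<in> carrier A \<Longrightarrow> mv_plus A x (mv_neg A (mv_zero A)) = mv_neg A (mv_zero A)"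
    and lukasiewicz: "\<lbrakk> x \<in> carrier A; y \<in> carrier A \<rbrakk> \<Longrightarrow>
      mv_plus A (mv_neg A (mv_plus A (mv_neg A x) y)) y =
      mv_plus A (mv_neg A (mv_plus A (mv_neg A y) x)) x"

definition mv_one :: "('a, 'r) mv_scheme \<Rightarrow> 'a"
  where "mv_one A = mv_neg A (mv_zero A)"

definition mv_times :: "('a, 'r) mv_scheme \<Rightarrow> 'a \<Rightarrow> 'a \<Rightarrow> 'a"
  where "mv_times A x y = mv_neg A (mv_plus A (mv_neg A x) (mv_neg A y))"

definition mv_join :: "('a, 'r) mv_scheme \<Rightarrow> 'a \<Rightarrow> 'a \<Rightarrow> 'a"
  where "mv_join A x y = mv_plus A (mv_times A x (mv_neg A y)) y"

definition mv_semiring :: "('a, 'r) mv_scheme \<Rightarrow> 'a ring"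
  where "mv_semiring A =
    \<lparr> carrier = carrier A, mult = mv_times A, one = mv_one A,
      zero = mv_zero A, add = mv_join A \<rparr>"

definition mv_semimodule :: "('a, 'r) mv_scheme \<Rightarrow> ('a, 'a) module"
  where "mv_semimodule A =
    \<lparr> carrier = carrier A, mult = undefined, one = undefined,
      zero = mv_zero A, add = mv_join A, smult = mv_times A \<rparr>"

definition mv_principal :: "('a, 'r) mv_scheme \<Rightarrow> 'a \<Rightarrow> 'a set"
  where "mv_principal A u = {mv_times A a u | a. a \<in> carrier A}"

context mv_algebra
begin

interpretation P: Group.comm_monoid
  "\<lparr> carrier = carrier A, mult = mv_plus A, one = mv_zero A \<rparr>"
  by (rule comm_monoid)

lemma plus_closed: "\<lbrakk> x \<in> carrier A; y \<in> carrier A \<rbrakk> \<Longrightarrow> mv_plus A x y \<in> carrier A"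
  using P.m_closed by simp

lemma zero_closed: "mv_zero A \<in> carrier A"
  using P.one_closed by simp

lemma one_closed: "mv_one A \<in> carrier A"
  by (simp add: mv_one_def zero_closed neg_closed)

lemma plus_assoc: "\<lbrakk> x \<in> carrier A; y \<in> carrier A; z \<in> carrier A \<rbrakk> \<Longrightarrow>
  mv_plus A (mv_plus A x y) z = mv_plus A x (mv_plus A y z)"
  using P.m_assoc by simp

lemma plus_comm: "\<lbrakk> x \<in> carrier A; y \<in> carrier A \<rbrakk> \<Longrightarrow> mv_plus A x y = mv_plus A y x"
  using P.m_comm by simp

lemma plus_zero: "x \<in> carrier A \<Longrightarrow> mv_plus A x (mv_zero A) = x"
  using P.r_one by simp

lemma times_closed: "\<lbrakk> x \<in> carrier A; y \<in> carrier A \<rbrakk> \<Longrightarrow> mv_times A x y \<in> carrier A"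
  by (simp add: mv_times_def plus_closed neg_closed)

lemma join_closed: "\<lbrakk> x \<in> carrier A; y \<in> carrier A \<rbrakk> \<Longrightarrow> mv_join A x y \<in> carrier A"
  by (simp add: mv_join_def plus_closed times_closed neg_closed)

lemma times_assoc: "\<lbrakk> x \<in> carrier A; y \<in> carrier A; z \<in> carrier A \<rbrakk> \<Longrightarrow>
  mv_times A (mv_times A x y) z = mv_times A x (mv_times A y z)"
  by (simp add: mv_times_def neg_neg plus_closed neg_closed plus_assoc)

lemma times_comm: "\<lbrakk> x \<in> carrier A; y \<in> carrier A \<rbrakk> \<Longrightarrow> mv_times A x y = mv_times A y x"
  by (simp add: mv_times_def neg_closed plus_comm)

lemma times_one: "x \<in> carrier A \<Longrightarrow> mv_times A x (mv_one A) = x"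
  by (simp add: mv_times_def mv_one_def neg_neg zero_closed neg_closed plus_zero)

lemma times_zero: "x \<in> carrier A \<Longrightarrow> mv_times A x (mv_zero A) = mv_zero A"
  by (simp add: mv_times_def neg_neg zero_closed neg_closed plus_neg_zero)

lemma join_eq: "\<lbrakk> x \<in> carrier A; y \<in> carrier A \<rbrakk> \<Longrightarrow>
  mv_join A x y = mv_plus A (mv_neg A (mv_plus A (mv_neg A x) y)) y"
  by (simp add: mv_join_def mv_times_def neg_neg)

lemma join_comm: "\<lbrakk> x \<in> carrier A; y \<in> carrier A \<rbrakk> \<Longrightarrow> mv_join A x y = mv_join A y x"
  by (simp add: join_eq lukasiewicz)

lemma neg_one: "mv_neg A (mv_one A) = mv_zero A"
  by (simp add: mv_one_def neg_neg zero_closed)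

lemma plus_one: "x \<in> carrier A \<Longrightarrow> mv_plus A x (mv_one A) = mv_one A"
  by (simp add: mv_one_def plus_neg_zero)

lemma zero_plus: "x \<in> carrier A \<Longrightarrow> mv_plus A (mv_zero A) x = x"
  using P.l_one by simp

lemma neg_plus_self: "x \<in> carrier A \<Longrightarrow> mv_plus A (mv_neg A x) x = mv_one A"
  using lukasiewicz[of "mv_one A" x]
  by (simp add: one_closed neg_one zero_plus plus_one neg_closed)

definition mv_le :: "'a \<Rightarrow> 'a \<Rightarrow> bool"
  where "mv_le x y \<longleftrightarrow> mv_plus A (mv_neg A x) y = mv_one A"

lemma le_join: "\<lbrakk> x \<in> carrier A; y \<in> carrier A; mv_le x y \<rbrakk> \<Longrightarrow> mv_join A x y = y"
  by (simp add: join_eq mv_le_def neg_one zero_plus)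

lemma le_plus: "\<lbrakk> x \<in> carrier A; y \<in> carrier A \<rbrakk> \<Longrightarrow> mv_le x (mv_plus A y x)"
  unfolding mv_le_def
  by (metis neg_closed neg_plus_self plus_assoc plus_closed plus_comm plus_one)

lemma le_iff: "\<lbrakk> x \<in> carrier A; y \<in> carrier A \<rbrakk> \<Longrightarrow>
    mv_le x y \<longleftrightarrow> (\<exists>z \<in> carrier A. y = mv_plus A z x)"
  by (metis le_join le_plus join_comm join_eq neg_closed plus_closed)

lemma le_refl: "x \<in> carrier A \<Longrightarrow> mv_le x x"
  by (simp add: mv_le_def neg_plus_self)

lemma le_antisym: "\<lbrakk> x \<in> carrier A; y \<in> carrier A; mv_le x y; mv_le y x \<rbrakk> \<Longrightarrow> x = y"
  by (metis join_comm le_join)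

lemma le_trans:
  "\<lbrakk> x \<in> carrier A; y \<in> carrier A; z \<in> carrier A; mv_le x y; mv_le y z \<rbrakk> \<Longrightarrow> mv_le x z"
  by (smt (verit) le_iff plus_assoc plus_closed)

lemma plus_mono: "\<lbrakk> x \<in> carrier A; y \<in> carrier A; w \<in> carrier A; mv_le x y \<rbrakk> \<Longrightarrow>
    mv_le (mv_plus A x w) (mv_plus A y w)"
  by (smt (verit) le_iff plus_assoc plus_closed)

lemma neg_antimono: "\<lbrakk> x \<in> carrier A; y \<in> carrier A; mv_le x y \<rbrakk> \<Longrightarrow>
    mv_le (mv_neg A y) (mv_neg A x)"
  by (simp add: mv_le_def neg_neg plus_comm neg_closed)

lemma join_ge2: "\<lbrakk> x \<in> carrier A; y \<in> carrier A \<rbrakk> \<Longrightarrow> mv_le y (mv_join A x y)"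
  by (simp add: join_eq le_plus plus_closed neg_closed)

lemma join_ge1: "\<lbrakk> x \<in> carrier A; y \<in> carrier A \<rbrakk> \<Longrightarrow> mv_le x (mv_join A x y)"
  using join_comm join_ge2 by metis

lemma join_least:
  assumes c: "x \<in> carrier A" "y \<in> carrier A" "z \<in> carrier A" and le: "mv_le x z" "mv_le y z"
  shows "mv_le (mv_join A x y) z"
proof -
  have "mv_le (mv_join A x y) (mv_join A z y)"
    using c le by (simp add: join_eq plus_mono neg_antimono plus_closed neg_closed)
  moreover have "mv_join A z y = z"
    using c le by (metis join_comm le_join)
  ultimately show ?thesis by simp
qed

lemma join_le_iff: "\<lbrakk> x \<in> carrier A; y \<in> carrier A; z \<in> carrier A \<rbrakk> \<Longrightarrow>
    mv_le (mv_join A x y) z \<longleftrightarrow> mv_le x z \<and> mv_le y z"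
  by (meson join_closed join_ge1 join_ge2 join_least le_trans)

lemma times_le_iff: "\<lbrakk> x \<in> carrier A; y \<in> carrier A; z \<in> carrier A \<rbrakk> \<Longrightarrow>
    mv_le (mv_times A x y) z \<longleftrightarrow> mv_le y (mv_plus A (mv_neg A x) z)"
  unfolding mv_le_def mv_times_def
  by (metis neg_closed neg_neg plus_assoc plus_closed plus_comm)

lemma eq_if_le_iff:
  assumes "x \<in> carrier A" "y \<in> carrier A" "\<And>w. w \<in> carrier A \<Longrightarrow> mv_le x w \<longleftrightarrow> mv_le y w"
  shows "x = y"
  using assms le_refl le_antisym by blast

lemma join_assoc: "\<lbrakk> x \<in> carrier A; y \<in> carrier A; z \<in> carrier A \<rbrakk> \<Longrightarrow>
    mv_join A (mv_join A x y) z = mv_join A x (mv_join A y z)"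
  by (rule eq_if_le_iff) (auto simp: join_closed join_le_iff)

lemma times_join: "\<lbrakk> x \<in> carrier A; y \<in> carrier A; z \<in> carrier A \<rbrakk> \<Longrightarrow>
    mv_times A x (mv_join A y z) = mv_join A (mv_times A x y) (mv_times A x z)"
  by (rule eq_if_le_iff)
    (auto simp: join_closed times_closed join_le_iff times_le_iff plus_closed neg_closed)

lemma zero_join: "x \<in> carrier A \<Longrightarrow> mv_join A (mv_zero A) x = x"
  by (rule le_join)
    (simp_all add: zero_closed mv_le_def flip: mv_one_def,
      metis one_closed plus_comm plus_one)

lemma join_zero: "x \<in> carrier A \<Longrightarrow> mv_join A x (mv_zero A) = x"
  by (metis join_comm zero_closed zero_join)

lemma join_lcomm: "\<lbrakk> x \<in> carrier A; y \<in> carrier A; z \<in> carrier A \<rbrakk> \<Longrightarrow>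
    mv_join A x (mv_join A y z) = mv_join A y (mv_join A x z)"
  by (metis join_assoc join_comm)

lemma one_times: "x \<in> carrier A \<Longrightarrow> mv_times A (mv_one A) x = x"
  by (metis one_closed times_comm times_one)

lemma zero_times: "x \<in> carrier A \<Longrightarrow> mv_times A (mv_zero A) x = mv_zero A"
  by (metis zero_closed times_comm times_zero)

lemma join_times: "\<lbrakk> x \<in> carrier A; y \<in> carrier A; z \<in> carrier A \<rbrakk> \<Longrightarrow>
    mv_times A (mv_join A x y) z = mv_join A (mv_times A x z) (mv_times A y z)"
  by (metis join_closed times_comm times_join)

lemma semiring_mv_semiring: "semiring (mv_semiring A)"
  by (intro semiring.intro semiring_axioms.intro abelian_monoid.intro comm_monoidI monoidI)
    (simp_all add: mv_semiring_def join_closed join_assoc join_comm join_lcomm zero_closed zero_join join_zero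
      times_closed one_closed times_assoc times_one one_times times_zero zero_times
      times_join join_times)

lemma semimodule_mv_semimodule: "semimodule (mv_semiring A) (mv_semimodule A)"
  by (intro semimodule.intro semimodule_axioms.intro semiring_mv_semiring
      abelian_monoid.intro comm_monoidI)
    (simp_all add: mv_semiring_def mv_semimodule_def join_closed join_assoc join_comm
      join_lcomm zero_closed zero_join join_zero times_closed times_assoc times_zero zero_times one_times
      times_join join_times)

lemma subsemimodule_mv_principal:
  assumes u: "u \<in> carrier A"
  shows "subsemimodule (mv_principal A u) (mv_semiring A) (mv_semimodule A)"
  unfolding subsemimodule_def
proof (intro conjI ballI)
  show "mv_principal A u \<subseteq> carrier (mv_semimodule A)"
    using u by (auto simp: mv_principal_def mv_semimodule_def times_closed)
  show "\<zero>\<^bsub>mv_semimodule A\<^esub> \<in> mv_principal A u"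
    using u zero_closed zero_times by (force simp: mv_principal_def mv_semimodule_def)
next
  fix x y assume "x \<in> mv_principal A u" "y \<in> mv_principal A u"
  then obtain a b where "a \<in> carrier A" "b \<in> carrier A" "x = mv_times A a u" "y = mv_times A b u"
    by (auto simp: mv_principal_def)
  then show "x \<oplus>\<^bsub>mv_semimodule A\<^esub> y \<in> mv_principal A u"
    using u join_times[of a b u] join_closed[of a b]
    by (force simp: mv_principal_def mv_semimodule_def)
next
  fix b x assume "b \<in> carrier (mv_semiring A)" "x \<in> mv_principal A u"
  then obtain a where "a \<in> carrier A" "b \<in> carrier A" "x = mv_times A a u"
    by (auto simp: mv_principal_def mv_semiring_def)
  then show "b \<odot>\<^bsub>mv_semimodule A\<^esub> x \<in> mv_principal A u"
    using u times_assoc[of b a u] times_closed[of b a]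
    by (force simp: mv_principal_def mv_semimodule_def)
qed

lemma mv_principal_eq_generated:
  assumes u: "u \<in> carrier A"
  shows "mv_principal A u = subsemimodule_generated (mv_semiring A) (mv_semimodule A) {u}"
proof
  have "u \<in> mv_principal A u"
    using u one_closed one_times by (force simp: mv_principal_def)
  then show "subsemimodule_generated (mv_semiring A) (mv_semimodule A) {u} \<subseteq> mv_principal A u"
    using subsemimodule_mv_principal[OF u] by (auto simp: subsemimodule_generated_def)
  show "mv_principal A u \<subseteq> subsemimodule_generated (mv_semiring A) (mv_semimodule A) {u}"
    by (auto simp: subsemimodule_generated_def mv_principal_def subsemimodule_def
        mv_semiring_def mv_semimodule_def)
qed

end

end

theory Submission
  imports Defs
begin

text \<open>
  All three conditions say that \<open>M\<close> has a one-element dual basis: an element \<open>x\<close> of \<open>M\<close> and a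
  homomorphism \<open>\<theta> : M \<rightarrow> A\<close> with \<open>\<theta>(m) x = m\<close> for every \<open>m\<close>. Equivalently, \<open>M\<close> is a retract
  of \<open>A\<close>, since homomorphisms \<open>A \<rightarrow> M\<close> are the maps \<open>a \<mapsto> a x\<close>. Each condition is compared
  with this one.

  If \<open>M\<close> is projective and generated by \<open>x\<close>, then the surjection \<open>a \<mapsto> a x\<close> has a section \<open>\<theta>\<close>
  (\<open>projective_imp_dual_basis\<close>). Conversely, a dual basis lifts \<open>f : M \<rightarrow> C\<close> along \<open>g : B \<rightarrow> C\<close> by \<open>m \<mapsto> \<theta>(m) b\<close>, where
  \<open>g b = f x\<close> (\<open>dual_basis_imp_projective\<close>).

  For a dual basis the element \<open>u = \<theta>(x)\<close> is idempotent, because \<open>\<theta>(x) = \<theta>(\<theta>(x) x) = \<theta>(x) \<odot> \<theta>(x)\<close>,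
  and \<open>\<theta>\<close> is an isomorphism onto \<open>A \<odot> u\<close>. Conversely, for idempotent \<open>u\<close> an isomorphism
  \<open>M \<rightarrow> A \<odot> u\<close> is itself the \<open>\<theta>\<close> of a dual basis, with \<open>x\<close> the preimage of \<open>u\<close>
  (\<open>dual_basis_imp_principal\<close>, \<open>principal_imp_dual_basis\<close>).

  An isomorphism \<open>\<psi> : A \<rightarrow> M \<oplus> N\<close> gives the dual basis consisting of the first component of
  \<open>\<psi>(\<one>)\<close> and the map \<open>m \<mapsto> \<psi>\<^sup>-\<^sup>1(m, \<zero>)\<close>. For the converse, the
  idempotent \<open>u = \<theta>(x)\<close> is complemented by \<open>u\<^sup>*\<close>, so \<open>A\<close> splits as \<open>A \<odot> u \<oplus> A \<odot> u\<^sup>*\<close>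
  (\<open>summand_imp_dual_basis\<close>, \<open>dual_basis_imp_summand\<close>).
\<close>

section \<open>Homomorphisms and copies of semimodules\<close>

lemma semimodule_hom_closed:
  "\<lbrakk> h \<in> semimodule_hom R M N; x \<in> carrier M \<rbrakk> \<Longrightarrow> h x \<in> carrier N"
  by (auto simp: semimodule_hom_def)

lemma semimodule_hom_add:
  "\<lbrakk> h \<in> semimodule_hom R M N; x \<in> carrier M; y \<in> carrier M \<rbrakk> \<Longrightarrow>
    h (x \<oplus>\<^bsub>M\<^esub> y) = h x \<oplus>\<^bsub>N\<^esub> h y"
  by (auto simp: semimodule_hom_def)

lemma semimodule_hom_smult:
  "\<lbrakk> h \<in> semimodule_hom R M N; a \<in> carrier R; x \<in> carrier M \<rbrakk> \<Longrightarrow>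
    h (a \<odot>\<^bsub>M\<^esub> x) = a \<odot>\<^bsub>N\<^esub> h x"
  by (auto simp: semimodule_hom_def)

lemma semimodule_hom_compose:
  assumes "g \<in> semimodule_hom R L M" "h \<in> semimodule_hom R M N"
  shows "(\<lambda>x. h (g x)) \<in> semimodule_hom R L N"
  unfolding semimodule_hom_def
  using semimodule_hom_closed[OF assms(1)] semimodule_hom_closed[OF assms(2)]
  by (simp add: Pi_iff semimodule_hom_add[OF assms(1)] semimodule_hom_add[OF assms(2)]
      semimodule_hom_smult[OF assms(1)] semimodule_hom_smult[OF assms(2)])

text \<open>
  Transport of a semimodule along an injection of types. It moves \<open>A\<close> and \<open>M\<close> into the universe on
  which projectivity is tested.
\<close>

definition semimodule_copy :: "('m \<Rightarrow> 'u) \<Rightarrow> ('a, 'm) module \<Rightarrow> ('a, 'u) module"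
  where "semimodule_copy e M =
    \<lparr> carrier = e ` carrier M, mult = undefined, one = undefined, zero = e \<zero>\<^bsub>M\<^esub>,
      add = (\<lambda>x y. e (the_inv e x \<oplus>\<^bsub>M\<^esub> the_inv e y)), smult = (\<lambda>a x. e (a \<odot>\<^bsub>M\<^esub> the_inv e x)) \<rparr>"

lemma semimodule_semimodule_copy:
  assumes "semimodule R M" and e: "inj e"
  shows "semimodule R (semimodule_copy e M)"
proof -
  interpret semimodule R M by fact
  have inv_e: "the_inv e (e x) = x" for x
    using e by (rule the_inv_f_f)
  show ?thesis
    by (intro semimodule.intro semimodule_axioms.intro R.semiring_axioms
        abelian_monoid.intro comm_monoidI)
      (auto simp: semimodule_copy_def inv_e M.a_ac smult_assoc smult_l_distr smult_r_distr)
qed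

lemma semimodule_copy_hom:
  assumes "inj e"
  shows "e \<in> semimodule_hom R M (semimodule_copy e M)"
    and "the_inv e \<in> semimodule_hom R (semimodule_copy e M) M"
  using the_inv_f_f[OF assms]
  by (auto simp: semimodule_hom_def semimodule_copy_def)

text \<open>
  A surjection \<open>g\<close> onto a projective semimodule splits, by lifting the identity along \<open>g\<close>. Only
  surjections within the universe may be used, so \<open>g\<close> is conjugated with the two embeddings.
\<close>

lemma projective_semimodule_section:
  fixes B :: "('a, 'n) module" and P :: "('a, 'm) module"
    and d :: "'n \<Rightarrow> 'u" and e :: "'m \<Rightarrow> 'u"
  assumes proj: "projective_semimodule TYPE('u) R P"
    and "semimodule R B" "semimodule R P"
    and d: "inj d" and e: "inj e"
    and g: "g \<in> semimodule_hom R B P" "g ` carrier B = carrier P"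
  shows "\<exists>h \<in> semimodule_hom R P B. \<forall>x \<in> carrier P. g (h x) = x"
proof -
  let ?B = "semimodule_copy d B" and ?P = "semimodule_copy e P"
  let ?g = "\<lambda>x. e (g (the_inv d x))"
  have inv_d: "the_inv d (d x) = x" for x
    using d by (rule the_inv_f_f)
  have "?g \<in> semimodule_hom R ?B ?P"
    using semimodule_hom_compose[OF semimodule_copy_hom(2)[OF d] g(1)] semimodule_copy_hom(1)[OF e]
    by (rule semimodule_hom_compose)
  moreover have "?g ` carrier ?B = carrier ?P"
    by (simp add: semimodule_copy_def image_image inv_d flip: g(2))
  ultimately have "\<exists>h \<in> semimodule_hom R P ?B. \<forall>x \<in> carrier P. ?g (h x) = e x"
    using proj semimodule_semimodule_copy[OF assms(2) d] semimodule_semimodule_copy[OF assms(3) e]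
      semimodule_copy_hom(1)[OF e]
    unfolding projective_semimodule_def by (elim allE impE)
  then obtain h where h: "h \<in> semimodule_hom R P ?B" "\<forall>x \<in> carrier P. ?g (h x) = e x"
    by blast
  have "(\<lambda>x. the_inv d (h x)) \<in> semimodule_hom R P B"
    using h(1) semimodule_copy_hom(2)[OF d] by (rule semimodule_hom_compose)
  moreover have "g (the_inv d (h x)) = x" if "x \<in> carrier P" for x
    using h(2) that e by (auto dest: injD)
  ultimately show ?thesis
    by (intro bexI[of _ "\<lambda>x. the_inv d (h x)"] ballI)
qed

text \<open>The multiples of \<open>x\<close> are already closed under addition, because \<open>a x + b x = (a + b) x\<close>.\<close>

lemma (in semimodule) subsemimodule_generated_singleton:
  assumes x: "x \<in> carrier M"
  shows "subsemimodule_generated R M {x} = (\<lambda>a. a \<odot>\<^bsub>M\<^esub> x) ` carrier R"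
proof
  have "subsemimodule ((\<lambda>a. a \<odot>\<^bsub>M\<^esub> x) ` carrier R) R M"
    unfolding subsemimodule_def
  proof (intro conjI ballI)
    show "(\<lambda>a. a \<odot>\<^bsub>M\<^esub> x) ` carrier R \<subseteq> carrier M"
      using x by auto
    show "\<zero>\<^bsub>M\<^esub> \<in> (\<lambda>a. a \<odot>\<^bsub>M\<^esub> x) ` carrier R"
      using x by (intro image_eqI[of _ _ "\<zero>\<^bsub>R\<^esub>"]) auto
  next
    fix y z assume "y \<in> (\<lambda>a. a \<odot>\<^bsub>M\<^esub> x) ` carrier R" "z \<in> (\<lambda>a. a \<odot>\<^bsub>M\<^esub> x) ` carrier R"
    then show "y \<oplus>\<^bsub>M\<^esub> z \<in> (\<lambda>a. a \<odot>\<^bsub>M\<^esub> x) ` carrier R"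
      using x by (auto simp flip: smult_l_distr)
  next
    fix b y assume "b \<in> carrier R" "y \<in> (\<lambda>a. a \<odot>\<^bsub>M\<^esub> x) ` carrier R"
    then show "b \<odot>\<^bsub>M\<^esub> y \<in> (\<lambda>a. a \<odot>\<^bsub>M\<^esub> x) ` carrier R"
      using x by (auto simp flip: smult_assoc)
  qed
  moreover have "x \<in> (\<lambda>a. a \<odot>\<^bsub>M\<^esub> x) ` carrier R"
    using x by (intro image_eqI[of _ _ "\<one>\<^bsub>R\<^esub>"]) auto
  ultimately show "subsemimodule_generated R M {x} \<subseteq> (\<lambda>a. a \<odot>\<^bsub>M\<^esub> x) ` carrier R"
    by (auto simp: subsemimodule_generated_def)
  show "(\<lambda>a. a \<odot>\<^bsub>M\<^esub> x) ` carrier R \<subseteq> subsemimodule_generated R M {x}"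
    by (auto simp: subsemimodule_generated_def subsemimodule_def)
qed

context mv_algebra
begin

section \<open>Idempotents\<close>

lemma times_neg_self: "x \<in> carrier A \<Longrightarrow> mv_times A x (mv_neg A x) = mv_zero A"
  by (simp add: mv_times_def neg_neg neg_closed neg_plus_self neg_one)

text \<open>
  For idempotent \<open>u\<close> the defining formula of the join gives
  \<open>u \<or> u\<^sup>* = (u \<odot> u) \<oplus> u\<^sup>* = u \<oplus> u\<^sup>* = \<one>\<close>.
\<close>

lemma idempotent_join_neg:
  assumes "u \<in> carrier A" "mv_times A u u = u"
  shows "mv_join A u (mv_neg A u) = mv_one A"
  using assms plus_comm[of u "mv_neg A u"]
  by (simp add: mv_join_def neg_neg neg_closed neg_plus_self)

lemma idempotent_decompose:
  assumes a: "a \<in> carrier A" and u: "u \<in> carrier A" "mv_times A u u = u"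
  shows "mv_join A (mv_times A a u) (mv_times A a (mv_neg A u)) = a"
  using times_join[of a u "mv_neg A u"] a u
  by (simp add: idempotent_join_neg neg_closed times_one)

text \<open>In the decomposition \<open>u\<^sup>* = (u\<^sup>* \<odot> u) \<or> (u\<^sup>* \<odot> u\<^sup>*)\<close> the first term is \<open>\<zero>\<close>.\<close>

lemma neg_idempotent:
  assumes u: "u \<in> carrier A" "mv_times A u u = u"
  shows "mv_times A (mv_neg A u) (mv_neg A u) = mv_neg A u"
  using idempotent_decompose[OF neg_closed[OF u(1)] u] times_comm[of "mv_neg A u" u] u
  by (simp add: neg_closed times_neg_self times_closed zero_join)

lemma mem_principal_idempotent_iff:
  assumes u: "u \<in> carrier A" "mv_times A u u = u"
  shows "a \<in> mv_principal A u \<longleftrightarrow> a \<in> carrier A \<and> mv_times A a u = a"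
proof
  assume "a \<in> mv_principal A u"
  with u show "a \<in> carrier A \<and> mv_times A a u = a"
    by (auto simp: mv_principal_def times_closed times_assoc)
next
  assume "a \<in> carrier A \<and> mv_times A a u = a"
  then show "a \<in> mv_principal A u"
    unfolding mv_principal_def by force
qed

section \<open>One-element dual bases\<close>

definition mv_dual_basis :: "('a, 'm, 'p) module_scheme \<Rightarrow> 'm \<Rightarrow> ('m \<Rightarrow> 'a) \<Rightarrow> bool"
  where "mv_dual_basis M x \<theta> \<longleftrightarrow>
    x \<in> carrier M \<and> \<theta> \<in> semimodule_hom (mv_semiring A) M (mv_semimodule A) \<and>
    (\<forall>m \<in> carrier M. \<theta> m \<odot>\<^bsub>M\<^esub> x = m)"

lemma mv_dual_basisD:
  assumes "mv_dual_basis M x \<theta>"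
  shows "x \<in> carrier M" "\<theta> \<in> semimodule_hom (mv_semiring A) M (mv_semimodule A)"
    and "m \<in> carrier M \<Longrightarrow> \<theta> m \<in> carrier A"
    and "m \<in> carrier M \<Longrightarrow> \<theta> m \<odot>\<^bsub>M\<^esub> x = m"
    and "\<lbrakk> a \<in> carrier A; m \<in> carrier M \<rbrakk> \<Longrightarrow> \<theta> (a \<odot>\<^bsub>M\<^esub> m) = mv_times A a (\<theta> m)"
proof -
  show "x \<in> carrier M" and \<theta>: "\<theta> \<in> semimodule_hom (mv_semiring A) M (mv_semimodule A)"
    and "m \<in> carrier M \<Longrightarrow> \<theta> m \<odot>\<^bsub>M\<^esub> x = m"
    using assms unfolding mv_dual_basis_def by blast+
  show "m \<in> carrier M \<Longrightarrow> \<theta> m \<in> carrier A"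
    using semimodule_hom_closed[OF \<theta>] by (simp add: mv_semimodule_def)
  show "\<lbrakk> a \<in> carrier A; m \<in> carrier M \<rbrakk> \<Longrightarrow> \<theta> (a \<odot>\<^bsub>M\<^esub> m) = mv_times A a (\<theta> m)"
    using semimodule_hom_smult[OF \<theta>] by (simp add: mv_semiring_def mv_semimodule_def)
qed

text \<open>Apply \<open>\<theta>\<close> to \<open>\<theta>(m) x = m\<close>; the case \<open>m = x\<close> makes \<open>\<theta>(x)\<close> idempotent.\<close>

lemma mv_dual_basis_times:
  assumes b: "mv_dual_basis M x \<theta>" and m: "m \<in> carrier M"
  shows "mv_times A (\<theta> m) (\<theta> x) = \<theta> m"
  using mv_dual_basisD(5)[OF b mv_dual_basisD(3)[OF b m] mv_dual_basisD(1)[OF b]]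
    mv_dual_basisD(4)[OF b m]
  by simp

lemma smult_hom:
  assumes "semimodule (mv_semiring A) M" "x \<in> carrier M"
  shows "(\<lambda>a. a \<odot>\<^bsub>M\<^esub> x) \<in> semimodule_hom (mv_semiring A) (mv_semimodule A) M"
proof -
  interpret semimodule "mv_semiring A" M by fact
  have [simp]: "carrier (mv_semimodule A) = carrier (mv_semiring A)"
    "add (mv_semimodule A) = add (mv_semiring A)" "smult (mv_semimodule A) = mult (mv_semiring A)"
    by (simp_all add: mv_semimodule_def mv_semiring_def)
  show ?thesis
    using assms(2) by (auto simp: semimodule_hom_def smult_assoc smult_l_distr)
qed

lemma projective_imp_dual_basis:
  fixes M :: "('a, 'm) module" and d :: "'a \<Rightarrow> 'u" and e :: "'m \<Rightarrow> 'u"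
  assumes "projective_semimodule TYPE('u) (mv_semiring A) M"
    and M: "semimodule (mv_semiring A) M"
    and cyc: "cyclic_semimodule (mv_semiring A) M"
    and inj: "inj d" "inj e"
  shows "\<exists>x \<theta>. mv_dual_basis M x \<theta>"
proof -
  interpret semimodule "mv_semiring A" M by fact
  obtain x where x: "x \<in> carrier M" "subsemimodule_generated (mv_semiring A) M {x} = carrier M"
    using cyc by (auto simp: cyclic_semimodule_def)
  have "(\<lambda>a. a \<odot>\<^bsub>M\<^esub> x) ` carrier (mv_semimodule A) = carrier M"
    using subsemimodule_generated_singleton[OF x(1)] x(2)
    by (simp add: mv_semimodule_def mv_semiring_def)
  then obtain \<theta> where "\<theta> \<in> semimodule_hom (mv_semiring A) M (mv_semimodule A)"
    "\<forall>m \<in> carrier M. \<theta> m \<odot>\<^bsub>M\<^esub> x = m"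
    using projective_semimodule_section[OF assms(1) semimodule_mv_semimodule M inj smult_hom[OF M x(1)]]
    by blast
  with x(1) show ?thesis
    unfolding mv_dual_basis_def by blast
qed

lemma dual_basis_imp_projective:
  assumes b: "mv_dual_basis M x \<theta>"
  shows "projective_semimodule TYPE('u) (mv_semiring A) M"
  unfolding projective_semimodule_def
proof (intro allI impI)
  fix B C :: "('a, 'u) module" and g f
  assume B: "semimodule (mv_semiring A) B"
    and g: "g \<in> semimodule_hom (mv_semiring A) B C" "g ` carrier B = carrier C"
    and f: "f \<in> semimodule_hom (mv_semiring A) M C"
  have "f x \<in> g ` carrier B"
    using g(2) semimodule_hom_closed[OF f mv_dual_basisD(1)[OF b]] by simp
  then obtain y where y: "y \<in> carrier B" "g y = f x"
    by auto
  have "(\<lambda>m. \<theta> m \<odot>\<^bsub>B\<^esub> y) \<in> semimodule_hom (mv_semiring A) M B"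
    using mv_dual_basisD(2)[OF b] smult_hom[OF B y(1)] by (rule semimodule_hom_compose)
  moreover have "g (\<theta> m \<odot>\<^bsub>B\<^esub> y) = f m" if m: "m \<in> carrier M" for m
  proof -
    have \<theta>m: "\<theta> m \<in> carrier (mv_semiring A)"
      using mv_dual_basisD(3)[OF b m] by (simp add: mv_semiring_def)
    then have "g (\<theta> m \<odot>\<^bsub>B\<^esub> y) = f (\<theta> m \<odot>\<^bsub>M\<^esub> x)"
      using y semimodule_hom_smult[OF g(1)] semimodule_hom_smult[OF f] mv_dual_basisD(1)[OF b]
      by simp
    then show ?thesis
      using mv_dual_basisD(4)[OF b m] by simp
  qed
  ultimately show "\<exists>h \<in> semimodule_hom (mv_semiring A) M B. \<forall>m \<in> carrier M. g (h m) = f m"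
    by (intro bexI[of _ "\<lambda>m. \<theta> m \<odot>\<^bsub>B\<^esub> y"] ballI)
qed

lemma dual_basis_imp_principal:
  assumes M: "semimodule (mv_semiring A) M" and b: "mv_dual_basis M x \<theta>"
  shows "semimodule_isomorphic (mv_semiring A) M
    ((mv_semimodule A)\<lparr>carrier := mv_principal A (\<theta> x)\<rparr>)"
proof -
  interpret semimodule "mv_semiring A" M by fact
  note D = mv_dual_basisD[OF b]
  have "\<theta> ` carrier M = mv_principal A (\<theta> x)"
  proof
    show "\<theta> ` carrier M \<subseteq> mv_principal A (\<theta> x)"
      using D(1,3) mv_dual_basis_times[OF b] by (auto simp: mem_principal_idempotent_iff)
    have "a \<odot>\<^bsub>M\<^esub> x \<in> carrier M" if "a \<in> carrier A" for a
      using that D(1) by (intro smult_closed) (simp_all add: mv_semiring_def)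
    then show "mv_principal A (\<theta> x) \<subseteq> \<theta> ` carrier M"
      using D(1) by (auto simp: mv_principal_def simp flip: D(5))
  qed
  moreover have "inj_on \<theta> (carrier M)"
    using D(4) by (metis inj_onI)
  ultimately show ?thesis
    using D(2) unfolding semimodule_isomorphic_def
    by (intro bexI[of _ \<theta>])
      (auto simp: bij_betw_def semimodule_hom_def mv_semimodule_def)
qed

lemma principal_imp_dual_basis:
  assumes M: "semimodule (mv_semiring A) M"
    and u: "u \<in> carrier A" "mv_times A u u = u"
    and iso: "semimodule_isomorphic (mv_semiring A) M
      ((mv_semimodule A)\<lparr>carrier := mv_principal A u\<rparr>)"
  shows "\<exists>x \<theta>. mv_dual_basis M x \<theta>"
proof -
  interpret semimodule "mv_semiring A" M by fact
  obtain \<theta> where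
    \<theta>: "\<theta> \<in> semimodule_hom (mv_semiring A) M ((mv_semimodule A)\<lparr>carrier := mv_principal A u\<rparr>)"
    and bij: "bij_betw \<theta> (carrier M) (mv_principal A u)"
    using iso by (auto simp: semimodule_isomorphic_def)
  have mem: "\<theta> m \<in> carrier A" "mv_times A (\<theta> m) u = \<theta> m" if "m \<in> carrier M" for m
    using bij_betwE[OF bij] that mem_principal_idempotent_iff[OF u] by auto
  have "u \<in> \<theta> ` carrier M"
    using bij_betw_imp_surj_on[OF bij] mem_principal_idempotent_iff[OF u, of u] u by simp
  then obtain x where x: "x \<in> carrier M" "\<theta> x = u"
    by (elim imageE) simp
  have "\<theta> m \<odot>\<^bsub>M\<^esub> x = m" if m: "m \<in> carrier M" for m
  proof -
    have R: "\<theta> m \<in> carrier (mv_semiring A)"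
      using mem(1)[OF m] by (simp add: mv_semiring_def)
    have "\<theta> (\<theta> m \<odot>\<^bsub>M\<^esub> x) = \<theta> m"
      using semimodule_hom_smult[OF \<theta> R x(1)] mem(2)[OF m] x(2) by (simp add: mv_semimodule_def)
    then show ?thesis
      using bij R x(1) m by (auto simp: bij_betw_def dest: inj_onD)
  qed
  moreover have "\<theta> \<in> semimodule_hom (mv_semiring A) M (mv_semimodule A)"
    using \<theta> mem(1) by (auto simp: semimodule_hom_def mv_semimodule_def)
  ultimately show ?thesis
    using x(1) unfolding mv_dual_basis_def by blast
qed

section \<open>Direct summands of the free semimodule\<close>

text \<open>
  With \<open>u = \<theta>(x)\<close>, the element \<open>a\<close> is recovered from \<open>(a x, a \<odot> u\<^sup>*)\<close> as
  \<open>\<theta>(a x) \<or> (a \<odot> u\<^sup>*) = (a \<odot> u) \<or> (a \<odot> u\<^sup>*)\<close>. That every pair is attained rests on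
  \<open>u\<^sup>* x = \<zero>\<close>, which holds because \<open>\<theta>(u\<^sup>* x) = u\<^sup>* \<odot> u = \<zero>\<close> and \<open>\<theta>(u\<^sup>* x) x = u\<^sup>* x\<close>.
\<close>

lemma dual_basis_imp_summand:
  assumes M: "semimodule (mv_semiring A) M" and b: "mv_dual_basis M x \<theta>"
  shows "semimodule_isomorphic (mv_semiring A) (mv_semimodule A)
    (semimodule_direct_sum M
      ((mv_semimodule A)\<lparr>carrier := mv_principal A (mv_neg A (\<theta> x))\<rparr>))"
proof -
  interpret semimodule "mv_semiring A" M by fact
  define u v where "u = \<theta> x" and "v = mv_neg A u"
  note D = mv_dual_basisD[OF b]
  have u: "u \<in> carrier A" "mv_times A u u = u"
    using D(1,3) mv_dual_basis_times[OF b D(1)] by (auto simp: u_def)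
  have v: "v \<in> carrier A" "mv_times A v v = v"
    using u by (simp_all add: v_def neg_closed neg_idempotent)
  have uv: "mv_times A u v = mv_zero A"
    using u by (simp add: v_def times_neg_self)
  have smult: "a \<odot>\<^bsub>M\<^esub> m \<in> carrier M" if "a \<in> carrier A" "m \<in> carrier M" for a m
    using that by (intro smult_closed) (simp_all add: mv_semiring_def)
  have \<theta>x: "\<theta> (a \<odot>\<^bsub>M\<^esub> x) = mv_times A a u" if "a \<in> carrier A" for a
    using that D(1,5) by (simp add: u_def)
  have smult_zero: "mv_zero A \<odot>\<^bsub>M\<^esub> m = \<zero>\<^bsub>M\<^esub>" if "m \<in> carrier M" for m
    using smult_l_zero[OF that] by (simp add: mv_semiring_def)
  have vx: "v \<odot>\<^bsub>M\<^esub> x = \<zero>\<^bsub>M\<^esub>"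
    using D(4)[OF smult[OF v(1) D(1)]] \<theta>x[OF v(1)] uv times_comm[OF u(1) v(1)] smult_zero[OF D(1)]
    by simp
  let ?S = "semimodule_direct_sum M ((mv_semimodule A)\<lparr>carrier := mv_principal A v\<rparr>)"
  let ?\<psi> = "\<lambda>a. (a \<odot>\<^bsub>M\<^esub> x, mv_times A a v)"
  have "?\<psi> \<in> semimodule_hom (mv_semiring A) (mv_semimodule A) ?S"
    using smult_hom[OF M D(1)] v(1)
    by (auto simp: semimodule_hom_def semimodule_direct_sum_def mv_semimodule_def mv_semiring_def
        mv_principal_def join_times times_assoc)
  moreover have "inj_on ?\<psi> (carrier A)"
  proof (rule inj_onI)
    fix a c assume ac: "a \<in> carrier A" "c \<in> carrier A" "?\<psi> a = ?\<psi> c"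
    then have eq: "mv_times A a u = mv_times A c u" "mv_times A a v = mv_times A c v"
      by (auto simp flip: \<theta>x)
    have "a = mv_join A (mv_times A a u) (mv_times A a v)"
      unfolding v_def using idempotent_decompose[OF ac(1) u] by (rule sym)
    also have "\<dots> = mv_join A (mv_times A c u) (mv_times A c v)"
      by (simp only: eq)
    also have "\<dots> = c"
      unfolding v_def using idempotent_decompose[OF ac(2) u] .
    finally show "a = c" .
  qed
  moreover have "?\<psi> ` carrier A = carrier ?S"
  proof
    have "mv_times A a v \<in> mv_principal A v" if "a \<in> carrier A" for a
      unfolding mv_principal_def using that by blast
    then show "?\<psi> ` carrier A \<subseteq> carrier ?S"
      using D(1) smult by (intro image_subsetI) (simp add: semimodule_direct_sum_def)
    show "carrier ?S \<subseteq> ?\<psi> ` carrier A"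
    proof
      fix p assume "p \<in> carrier ?S"
      then obtain m n where p: "p = (m, n)" and m: "m \<in> carrier M" and n: "n \<in> mv_principal A v"
        by (auto simp: semimodule_direct_sum_def)
      have nA: "n \<in> carrier A" and nv: "mv_times A n v = n"
        using n mem_principal_idempotent_iff[OF v] by auto
      have \<theta>m: "\<theta> m \<in> carrier A" "mv_times A (\<theta> m) u = \<theta> m"
        using D(3)[OF m] mv_dual_basis_times[OF b m] by (auto simp: u_def)
      have nx: "n \<odot>\<^bsub>M\<^esub> x = \<zero>\<^bsub>M\<^esub>"
        using smult_assoc[of n v x] nA v(1) nv D(1) vx smult_r_zero[of n]
        by (simp add: mv_semiring_def)
      have \<theta>v: "mv_times A (\<theta> m) v = mv_zero A"
        using times_assoc[OF \<theta>m(1) u(1) v(1)] \<theta>m uv by (simp add: times_zero)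
      have "mv_join A (\<theta> m) n \<odot>\<^bsub>M\<^esub> x = \<theta> m \<odot>\<^bsub>M\<^esub> x \<oplus>\<^bsub>M\<^esub> n \<odot>\<^bsub>M\<^esub> x"
        using smult_l_distr[of "\<theta> m" n x] \<theta>m(1) nA D(1) by (simp add: mv_semiring_def)
      moreover have "mv_times A (mv_join A (\<theta> m) n) v = n"
        using join_times[OF \<theta>m(1) nA v(1)] \<theta>v nv nA by (simp add: zero_join)
      ultimately have "p = ?\<psi> (mv_join A (\<theta> m) n)"
        using p m nx D(4) by simp
      then show "p \<in> ?\<psi> ` carrier A"
        using join_closed[OF \<theta>m(1) nA] by (rule image_eqI)
    qed
  qed
  ultimately show ?thesis
    unfolding semimodule_isomorphic_def u_def[symmetric] v_def[symmetric]
    by (intro bexI[of _ ?\<psi>]) (auto simp: bij_betw_def mv_semimodule_def)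
qed

text \<open>
  For an isomorphism \<open>\<psi>\<close> with \<open>\<psi>(\<one>) = (x, n)\<close>, the element \<open>a = \<psi>\<^sup>-\<^sup>1(m, \<zero>)\<close> satisfies
  \<open>(m, \<zero>) = \<psi>(a) = a \<psi>(\<one>) = (a x, a n)\<close>, so \<open>a x = m\<close>.
\<close>

lemma summand_imp_dual_basis:
  assumes M: "semimodule (mv_semiring A) M"
    and N: "subsemimodule N (mv_semiring A) (mv_semimodule A)"
    and iso: "semimodule_isomorphic (mv_semiring A) (mv_semimodule A)
      (semimodule_direct_sum M ((mv_semimodule A)\<lparr>carrier := N\<rparr>))"
  shows "\<exists>x \<theta>. mv_dual_basis M x \<theta>"
proof -
  interpret S: semimodule "mv_semiring A" M by fact
  let ?S = "semimodule_direct_sum M ((mv_semimodule A)\<lparr>carrier := N\<rparr>)"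
  obtain \<psi> where \<psi>: "\<psi> \<in> semimodule_hom (mv_semiring A) (mv_semimodule A) ?S"
    and bij: "bij_betw \<psi> (carrier A) (carrier ?S)"
    using iso by (auto simp: semimodule_isomorphic_def mv_semimodule_def)
  have zN: "mv_zero A \<in> N"
    using N by (simp add: subsemimodule_def mv_semimodule_def)
  obtain x n where xn: "\<psi> (mv_one A) = (x, n)"
    by fastforce
  have x: "x \<in> carrier M"
    using bij_betw_apply[OF bij one_closed] xn by (simp add: semimodule_direct_sum_def)
  define \<theta> where "\<theta> = (\<lambda>m. inv_into (carrier A) \<psi> (m, mv_zero A))"
  have \<theta>: "\<theta> m \<in> carrier A" "\<psi> (\<theta> m) = (m, mv_zero A)" if "m \<in> carrier M" for m
  proof -
    have "(m, mv_zero A) \<in> \<psi> ` carrier A"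
      using that zN bij by (simp add: bij_betw_def semimodule_direct_sum_def)
    then show "\<theta> m \<in> carrier A" "\<psi> (\<theta> m) = (m, mv_zero A)"
      unfolding \<theta>_def by (rule inv_into_into, rule f_inv_into_f)
  qed
  have \<psi>_join: "\<psi> (mv_join A a c) = \<psi> a \<oplus>\<^bsub>?S\<^esub> \<psi> c" if "a \<in> carrier A" "c \<in> carrier A" for a c
    using semimodule_hom_add[OF \<psi>, of a c] that by (simp add: mv_semimodule_def)
  have \<psi>_times: "\<psi> (mv_times A a c) = a \<odot>\<^bsub>?S\<^esub> \<psi> c" if "a \<in> carrier A" "c \<in> carrier A" for a c
    using semimodule_hom_smult[OF \<psi>, of a c] that by (simp add: mv_semimodule_def mv_semiring_def)
  have \<theta>_eq: "\<theta> m = a" if "m \<in> carrier M" "a \<in> carrier A" "\<psi> a = (m, mv_zero A)" for m a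
    using inj_onD[OF bij_betw_imp_inj_on[OF bij], of "\<theta> m" a] \<theta>[OF that(1)] that by simp
  have "\<theta> \<in> semimodule_hom (mv_semiring A) M (mv_semimodule A)"
    unfolding semimodule_hom_def
  proof (intro CollectI conjI ballI)
    show "\<theta> \<in> carrier M \<rightarrow> carrier (mv_semimodule A)"
      using \<theta>(1) by (simp add: mv_semimodule_def)
  next
    fix l m assume lm: "l \<in> carrier M" "m \<in> carrier M"
    have "\<psi> (mv_join A (\<theta> l) (\<theta> m)) = (l \<oplus>\<^bsub>M\<^esub> m, mv_zero A)"
      using lm \<theta> \<psi>_join zero_closed
      by (simp add: semimodule_direct_sum_def mv_semimodule_def zero_join)
    then show "\<theta> (l \<oplus>\<^bsub>M\<^esub> m) = \<theta> l \<oplus>\<^bsub>mv_semimodule A\<^esub> \<theta> m"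
      using \<theta>_eq[of "l \<oplus>\<^bsub>M\<^esub> m"] lm \<theta>(1) by (simp add: mv_semimodule_def join_closed)
  next
    fix a m assume a: "a \<in> carrier (mv_semiring A)" and m: "m \<in> carrier M"
    have aA: "a \<in> carrier A"
      using a by (simp add: mv_semiring_def)
    have "\<psi> (mv_times A a (\<theta> m)) = (a \<odot>\<^bsub>M\<^esub> m, mv_zero A)"
      using aA m \<theta> \<psi>_times by (simp add: semimodule_direct_sum_def mv_semimodule_def times_zero)
    then show "\<theta> (a \<odot>\<^bsub>M\<^esub> m) = a \<odot>\<^bsub>mv_semimodule A\<^esub> \<theta> m"
      using \<theta>_eq[of "a \<odot>\<^bsub>M\<^esub> m"] a aA m \<theta>(1) by (simp add: mv_semimodule_def times_closed)
  qed
  moreover have "\<theta> m \<odot>\<^bsub>M\<^esub> x = m" if "m \<in> carrier M" for m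
    using \<psi>_times[OF \<theta>(1)[OF that] one_closed] \<theta>[OF that] xn
    by (simp add: times_one semimodule_direct_sum_def)
  ultimately show ?thesis
    using x unfolding mv_dual_basis_def by blast
qed

end

theorem proposition4p12:
  fixes A :: "'a mv" and M :: "('a, 'm) module"
  assumes "mv_algebra A"
    and "semimodule (mv_semiring A) M"
    and "cyclic_semimodule (mv_semiring A) M"
  shows "(projective_semimodule TYPE('a + 'm + 'b) (mv_semiring A) M \<longleftrightarrow>
          (\<exists>u \<in> carrier A. mv_times A u u = u \<and>
             semimodule_isomorphic (mv_semiring A) M
               ((mv_semimodule A)\<lparr>carrier := mv_principal A u\<rparr>)))
       \<and> ((\<exists>u \<in> carrier A. mv_times A u u = u \<and>
             semimodule_isomorphic (mv_semiring A) M
               ((mv_semimodule A)\<lparr>carrier := mv_principal A u\<rparr>)) \<longleftrightarrow>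
          (\<exists>N. subsemimodule N (mv_semiring A) (mv_semimodule A) \<and>
             semimodule_isomorphic (mv_semiring A) (mv_semimodule A)
               (semimodule_direct_sum M ((mv_semimodule A)\<lparr>carrier := N\<rparr>))))"
proof -
  interpret mv_algebra A by fact
  note M = assms(2)
  let ?D = "\<exists>x \<theta>. mv_dual_basis M x \<theta>"
  let ?b = "\<exists>u \<in> carrier A. mv_times A u u = u \<and>
    semimodule_isomorphic (mv_semiring A) M ((mv_semimodule A)\<lparr>carrier := mv_principal A u\<rparr>)"
  let ?c = "\<exists>N. subsemimodule N (mv_semiring A) (mv_semimodule A) \<and>
    semimodule_isomorphic (mv_semiring A) (mv_semimodule A)
      (semimodule_direct_sum M ((mv_semimodule A)\<lparr>carrier := N\<rparr>))"
  have "inj (Inl :: 'a \<Rightarrow> 'a + 'm + 'b)" "inj (\<lambda>m. Inr (Inl m) :: 'a + 'm + 'b)"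
    by (auto simp: inj_def)
  then have "projective_semimodule TYPE('a + 'm + 'b) (mv_semiring A) M \<longleftrightarrow> ?D"
    using projective_imp_dual_basis[OF _ M assms(3)]
    by (intro iffI) (blast, elim exE, rule dual_basis_imp_projective)
  moreover have "?b \<longleftrightarrow> ?D"
  proof
    assume ?D
    then obtain x \<theta> where b: "mv_dual_basis M x \<theta>"
      by blast
    then have "\<theta> x \<in> carrier A" "mv_times A (\<theta> x) (\<theta> x) = \<theta> x"
      using mv_dual_basisD(1,3)[OF b] mv_dual_basis_times[OF b] by auto
    with dual_basis_imp_principal[OF M b] show ?b
      by (intro bexI[of _ "\<theta> x"] conjI)
  qed (elim bexE conjE, rule principal_imp_dual_basis[OF M])
  moreover have "?c \<longleftrightarrow> ?D"
  proof
    assume ?D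
    then obtain x \<theta> where b: "mv_dual_basis M x \<theta>"
      by blast
    then have "mv_neg A (\<theta> x) \<in> carrier A"
      using mv_dual_basisD(1,3)[OF b] by (simp add: neg_closed)
    then have "subsemimodule (mv_principal A (mv_neg A (\<theta> x))) (mv_semiring A) (mv_semimodule A)"
      by (rule subsemimodule_mv_principal)
    with dual_basis_imp_summand[OF M b] show ?c
      by (intro exI[of _ "mv_principal A (mv_neg A (\<theta> x))"] conjI)
  qed (elim exE conjE, rule summand_imp_dual_basis[OF M])
  ultimately show ?thesis
    by simp
qed

end
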